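(* Let $K$ be an uncountable algebraically closed field and let $(X_n,f_{nm})$ be a projective sequence of nonempty constructible sets over $K$. Then $\varprojlim X_n\neq\varnothing$.
   Context: $\mathbb N=\{0,1,2,\dots\}$. A projective sequence of sets $(X_n,f_{nm})$ is a sequence of sets $X_n$ ($n\in\mathbb N$) with maps $f_{nm}\colon X_m\to X_n$ for $m\ge n$ such that $f_{nn}=\mathrm{Id}$ and $f_{nk}=f_{nm}\circ f_{mk}$ for $k\ge m\ge n$; its projective limit is the set of $(x_n)\in\prod_n X_n$ with $x_n=f_{nm}(x_m)$ for all $m\ge n$. Affine algebraic sets over $K$ are zero sets of families of polynomials in some $K^m$, carrying the Zariski topology; regular maps are restrictions of polynomial maps. A subset of an affine algebraic set $A$ is locally closed if it is the intersection of an open and a closed subset of $A$, and constructible if it is a finite union of locally closed subsets. $(X_n,f_{nm})$ is a projective sequence of constructible sets over $K$ if there is a projective sequence $(A_n,F_{nm})$ of affine algebraic sets $A_n$ over $K$ and regular maps $F_{nm}\colon A_m\to A_n$ such that each $X_n$ is a constructible subset of $A_n$, $F_{nm}(X_m)\subset X_n$, and $f_{nm}$ is the restriction of $F_{nm}$ to $X_m$, for all $m\ge n$. *)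

theory Defs
  imports "HOL-Computational_Algebra.Polynomial" "HOL-Library.Countable_Set"
begin

text \<open>Points of K^m are lists of length m.  Polynomial functions K^m \<rightarrow> K in the
  coordinates x!0, ..., x!(m-1), generated by constants, coordinates, sums, products.\<close>

inductive_set poly_fun :: "nat \<Rightarrow> ('a::comm_ring_1 list \<Rightarrow> 'a) set" for m :: nat where
  pf_const: "(\<lambda>x. c) \<in> poly_fun m"
| pf_var: "i < m \<Longrightarrow> (\<lambda>x. x ! i) \<in> poly_fun m"
| pf_add: "p \<in> poly_fun m \<Longrightarrow> q \<in> poly_fun m \<Longrightarrow> (\<lambda>x. p x + q x) \<in> poly_fun m"
| pf_mult: "p \<in> poly_fun m \<Longrightarrow> q \<in> poly_fun m \<Longrightarrow> (\<lambda>x. p x * q x) \<in> poly_fun m"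

definition zero_set :: "nat \<Rightarrow> ('a::comm_ring_1 list \<Rightarrow> 'a) set \<Rightarrow> 'a list set" where
  "zero_set m P = {x. length x = m \<and> (\<forall>p\<in>P. p x = 0)}"

definition affine_alg_set :: "nat \<Rightarrow> 'a::comm_ring_1 list set \<Rightarrow> bool" where
  "affine_alg_set m A \<longleftrightarrow> (\<exists>P \<subseteq> poly_fun m. A = zero_set m P)"

definition zclosed_in :: "nat \<Rightarrow> 'a::comm_ring_1 list set \<Rightarrow> 'a list set \<Rightarrow> bool" where
  "zclosed_in m A S \<longleftrightarrow> (\<exists>P \<subseteq> poly_fun m. S = A \<inter> zero_set m P)"

definition zopen_in :: "nat \<Rightarrow> 'a::comm_ring_1 list set \<Rightarrow> 'a list set \<Rightarrow> bool" where
  "zopen_in m A U \<longleftrightarrow> U \<subseteq> A \<and> zclosed_in m A (A - U)"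

definition locally_closed_in :: "nat \<Rightarrow> 'a::comm_ring_1 list set \<Rightarrow> 'a list set \<Rightarrow> bool" where
  "locally_closed_in m A S \<longleftrightarrow> (\<exists>U C. zopen_in m A U \<and> zclosed_in m A C \<and> S = U \<inter> C)"

definition constructible_in :: "nat \<Rightarrow> 'a::comm_ring_1 list set \<Rightarrow> 'a list set \<Rightarrow> bool" where
  "constructible_in m A X \<longleftrightarrow>
     (\<exists>\<S>. finite \<S> \<and> (\<forall>S\<in>\<S>. locally_closed_in m A S) \<and> X = \<Union>\<S>)"

definition regular_map :: "nat \<Rightarrow> 'a::comm_ring_1 list set \<Rightarrow> nat \<Rightarrow> 'a list set
    \<Rightarrow> ('a list \<Rightarrow> 'a list) \<Rightarrow> bool" where
  "regular_map m A k B F \<longleftrightarrow>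
     (\<exists>ps. length ps = k \<and> set ps \<subseteq> poly_fun m \<and> (\<forall>x\<in>A. F x = map (\<lambda>p. p x) ps))
     \<and> F ` A \<subseteq> B"

definition proj_seq_affine :: "(nat \<Rightarrow> nat) \<Rightarrow> (nat \<Rightarrow> 'a::comm_ring_1 list set)
    \<Rightarrow> (nat \<Rightarrow> nat \<Rightarrow> 'a list \<Rightarrow> 'a list) \<Rightarrow> bool" where
  "proj_seq_affine d A F \<longleftrightarrow>
     (\<forall>n. affine_alg_set (d n) (A n))
   \<and> (\<forall>n m. n \<le> m \<longrightarrow> regular_map (d m) (A m) (d n) (A n) (F n m))
   \<and> (\<forall>n. \<forall>x\<in>A n. F n n x = x)
   \<and> (\<forall>n m k. n \<le> m \<longrightarrow> m \<le> k \<longrightarrow> (\<forall>x\<in>A k. F n k x = F n m (F m k x)))"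

text \<open>Projective sequence of constructible sets: X n \<subseteq> A n constructible, F n m (X m) \<subseteq> X n;
  the maps f n m are the restrictions of F n m to X m.\<close>
definition proj_seq_constructible :: "(nat \<Rightarrow> nat) \<Rightarrow> (nat \<Rightarrow> 'a::comm_ring_1 list set)
    \<Rightarrow> (nat \<Rightarrow> nat \<Rightarrow> 'a list \<Rightarrow> 'a list) \<Rightarrow> (nat \<Rightarrow> 'a list set) \<Rightarrow> bool" where
  "proj_seq_constructible d A F X \<longleftrightarrow>
     proj_seq_affine d A F
   \<and> (\<forall>n. constructible_in (d n) (A n) (X n))
   \<and> (\<forall>n m. n \<le> m \<longrightarrow> F n m ` X m \<subseteq> X n)"

definition proj_limit :: "(nat \<Rightarrow> 'b set) \<Rightarrow> (nat \<Rightarrow> nat \<Rightarrow> 'b \<Rightarrow> 'b) \<Rightarrow> (nat \<Rightarrow> 'b) set" where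
  "proj_limit X f = {x. (\<forall>n. x n \<in> X n) \<and> (\<forall>n m. n \<le> m \<longrightarrow> x n = f n m (x m))}"

definition alg_closed_field :: "'a::field itself \<Rightarrow> bool" where
  "alg_closed_field _ \<longleftrightarrow> (\<forall>p :: 'a poly. degree p > 0 \<longrightarrow> (\<exists>x. poly p x = 0))"

end

theory Submission
  imports Defs "HOL-Library.Function_Algebras"
begin

text \<open>A point of the limit is a common zero of a system of polynomials in countably many variables:
  each \<open>X n\<close> is a projection of a closed set (Rabinowitsch's trick introduces the auxiliary
  coordinates), and the compatibility \<open>x n = F n m (x m)\<close> is polynomial. Finitely many of these
  equations involve only indices up to some \<open>N\<close> and are solved by the images of one point of
  \<open>X N\<close>, so they do not generate the unit ideal. Over an uncountable algebraically closed field
  the Nullstellensatz persists in countably many variables, because the polynomial ring has countable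
  dimension whereas the functions \<open>1 / (x - b)\<close> form an uncountable independent family.\<close>

section \<open>Ideals in subrings\<close>

text \<open>Polynomial rings will appear as subsets \<open>S\<close> of a ring of functions, so
  coefficients are restricted to \<open>S\<close>. Adding one summand at a time makes each
  membership visibly finite.\<close>

inductive_set ideal_gen :: "'r::comm_ring_1 set \<Rightarrow> 'r set \<Rightarrow> 'r set"
  for S G :: "'r set" where
  zero: "0 \<in> ideal_gen S G"
| step: "s \<in> S \<Longrightarrow> g \<in> G \<Longrightarrow> h \<in> ideal_gen S G \<Longrightarrow> s * g + h \<in> ideal_gen S G"

lemma ideal_gen_mono:
  assumes "G \<subseteq> H"
  shows "ideal_gen S G \<subseteq> ideal_gen S H"
proof
  fix h assume "h \<in> ideal_gen S G"
  then show "h \<in> ideal_gen S H"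
    by induction (use assms in \<open>auto intro: ideal_gen.intros\<close>)
qed

lemma ideal_gen_add:
  assumes "a \<in> ideal_gen S G" and "b \<in> ideal_gen S G"
  shows "a + b \<in> ideal_gen S G"
  using assms by induction (auto simp: add.assoc intro: ideal_gen.intros)

text \<open>Compactness of ideal membership, needed for unions of chains and for the infinite system
  of equations describing the limit.\<close>

lemma ideal_gen_finite_support:
  assumes "h \<in> ideal_gen S G"
  shows "\<exists>G0\<subseteq>G. finite G0 \<and> h \<in> ideal_gen S G0"
  using assms
proof induction
  case zero
  show ?case by (rule exI[of _ "{}"]) (simp add: ideal_gen.zero)
next
  case (step s g h)
  then obtain G0 where "G0 \<subseteq> G" "finite G0" "h \<in> ideal_gen S G0"
    by blast
  moreover from this have "s * g + h \<in> ideal_gen S (insert g G0)"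
    using step(1) ideal_gen_mono[of G0 "insert g G0" S] by (auto intro!: ideal_gen.step)
  ultimately show ?case
    using step(2) by (intro exI[of _ "insert g G0"]) auto
qed

lemma finite_subset_ideal_gen:
  assumes "finite Q" and "Q \<subseteq> ideal_gen S G"
  shows "\<exists>G0\<subseteq>G. finite G0 \<and> Q \<subseteq> ideal_gen S G0"
  using assms
proof (induction Q)
  case empty
  then show ?case by auto
next
  case (insert q Q)
  then obtain G0 G1 where "G0 \<subseteq> G" "finite G0" "Q \<subseteq> ideal_gen S G0"
    and "G1 \<subseteq> G" "finite G1" "q \<in> ideal_gen S G1"
    using ideal_gen_finite_support[of q S G] by auto
  then show ?case
    using ideal_gen_mono[of G0 "G0 \<union> G1" S] ideal_gen_mono[of G1 "G0 \<union> G1" S]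
    by (intro exI[of _ "G0 \<union> G1"]) auto
qed

lemma ideal_gen_eval_zero:
  assumes "h \<in> ideal_gen S G" and "\<And>g. g \<in> G \<Longrightarrow> g v = 0"
  shows "h v = 0"
  using assms(1) by induction (simp_all add: assms(2))

locale subring_set =
  fixes S :: "'r::comm_ring_1 set"
  assumes one_in: "1 \<in> S"
    and diff_in: "a \<in> S \<Longrightarrow> b \<in> S \<Longrightarrow> a - b \<in> S"
    and mult_in: "a \<in> S \<Longrightarrow> b \<in> S \<Longrightarrow> a * b \<in> S"
begin

lemma zero_in: "0 \<in> S"
  using diff_in[OF one_in one_in] by simp

lemma uminus_in: "a \<in> S \<Longrightarrow> - a \<in> S"
  using diff_in[OF zero_in] by fastforce

lemma add_in: "a \<in> S \<Longrightarrow> b \<in> S \<Longrightarrow> a + b \<in> S"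
  using diff_in[OF _ uminus_in] by fastforce

lemma power_in: "a \<in> S \<Longrightarrow> a ^ n \<in> S"
  by (induction n) (auto intro: one_in mult_in)

lemma sum_in: "(\<And>i. i \<in> I \<Longrightarrow> f i \<in> S) \<Longrightarrow> sum f I \<in> S"
  by (induction I rule: infinite_finite_induct) (auto intro: zero_in add_in)

lemma ideal_gen_base:
  assumes "g \<in> G"
  shows "g \<in> ideal_gen S G"
  using ideal_gen.step[OF one_in assms ideal_gen.zero] by simp

lemma ideal_gen_mult:
  assumes "h \<in> ideal_gen S G" and "t \<in> S"
  shows "t * h \<in> ideal_gen S G"
  using assms(1)
proof induction
  case zero
  then show ?case by (simp add: ideal_gen.zero)
next
  case (step s g h)
  then have "(t * s) * g + t * h \<in> ideal_gen S G"
    using assms(2) by (intro ideal_gen.step mult_in)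
  then show ?case by (simp add: algebra_simps)
qed

lemma ideal_gen_diff:
  assumes "a \<in> ideal_gen S G" and "b \<in> ideal_gen S G"
  shows "a - b \<in> ideal_gen S G"
  using ideal_gen_add[OF assms(1) ideal_gen_mult[OF assms(2) uminus_in[OF one_in]]] by simp

lemma ideal_gen_sum:
  assumes "\<And>i. i \<in> I \<Longrightarrow> f i \<in> ideal_gen S G"
  shows "sum f I \<in> ideal_gen S G"
  using assms
  by (induction I rule: infinite_finite_induct) (auto intro: ideal_gen.zero ideal_gen_add)

lemma ideal_gen_trans:
  assumes "G \<subseteq> ideal_gen S H"
  shows "ideal_gen S G \<subseteq> ideal_gen S H"
proof
  fix h assume "h \<in> ideal_gen S G"
  then show "h \<in> ideal_gen S H"
    by induction (use assms in \<open>auto intro: ideal_gen.zero ideal_gen_add ideal_gen_mult\<close>)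
qed

lemma ideal_gen_subset:
  assumes "G \<subseteq> S"
  shows "ideal_gen S G \<subseteq> S"
proof
  fix h assume "h \<in> ideal_gen S G"
  then show "h \<in> S"
    by induction (use assms in \<open>auto intro: zero_in add_in mult_in\<close>)
qed

text \<open>Collecting the coefficients of \<open>l\<close> gives \<open>s\<close>. For
  \<open>h = 1\<close> the element \<open>s\<close> is an inverse of \<open>l\<close> modulo the
  ideal of \<open>G\<close>.\<close>

lemma ideal_gen_insertD:
  assumes "h \<in> ideal_gen S (insert l G)"
  shows "\<exists>s\<in>S. h - s * l \<in> ideal_gen S G"
  using assms
proof induction
  case zero
  show ?case
    by (rule bexI[OF _ zero_in]) (simp add: ideal_gen.zero)
next
  case (step s g h)
  then obtain t where t: "t \<in> S" "h - t * l \<in> ideal_gen S G"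
    by blast
  show ?case
  proof (cases "g = l")
    case True
    then show ?thesis
      using t step(1) by (intro bexI[of _ "s + t"]) (auto simp: algebra_simps intro: add_in)
  next
    case False
    then have "s * g + (h - t * l) \<in> ideal_gen S G"
      using step(1,2) t by (intro ideal_gen.step) auto
    then show ?thesis
      using t(1) by (intro bexI[of _ t]) (auto simp: algebra_simps)
  qed
qed

end

section \<open>Hilbert's basis theorem\<close>

text \<open>Drawing \<open>Q0\<close> from \<open>Q\<close> itself bounds the indices of the leading
  coefficients that occur in the basis theorem, and later selects finitely many of the given
  equations.\<close>

definition noetherian_set :: "'r::comm_ring_1 set \<Rightarrow> bool" where
  "noetherian_set S \<longleftrightarrow> (\<forall>Q\<subseteq>S. \<exists>Q0\<subseteq>Q. finite Q0 \<and> Q \<subseteq> ideal_gen S Q0)"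

definition polys_over :: "'r::comm_ring_1 set \<Rightarrow> 'r poly set" where
  "polys_over S = {p. \<forall>i. coeff p i \<in> S}"

text \<open>As the image of an evaluation map this allows \<open>x\<close> to satisfy relations over
  \<open>S\<close>, so algebraic independence of the coordinate functions never has to be
  shown.\<close>

definition adjoin :: "'r::comm_ring_1 set \<Rightarrow> 'r \<Rightarrow> 'r set" where
  "adjoin S x = (\<lambda>p. poly p x) ` polys_over S"

context subring_set
begin

lemma polys_over_diff: "p \<in> polys_over S \<Longrightarrow> q \<in> polys_over S \<Longrightarrow> p - q \<in> polys_over S"
  by (auto simp: polys_over_def intro: diff_in)

lemma polys_over_add: "p \<in> polys_over S \<Longrightarrow> q \<in> polys_over S \<Longrightarrow> p + q \<in> polys_over S"
  by (auto simp: polys_over_def intro: add_in)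

lemma polys_over_mult: "p \<in> polys_over S \<Longrightarrow> q \<in> polys_over S \<Longrightarrow> p * q \<in> polys_over S"
  by (auto simp: polys_over_def coeff_mult intro!: sum_in mult_in)

lemma polys_over_monom: "s \<in> S \<Longrightarrow> monom s n \<in> polys_over S"
  by (auto simp: polys_over_def intro: zero_in)

lemma subring_adjoin: "subring_set (adjoin S x)"
proof
  have "poly (monom 1 0) x \<in> adjoin S x"
    unfolding adjoin_def by (intro imageI polys_over_monom one_in)
  then show "1 \<in> adjoin S x" by (simp add: poly_monom)
next
  fix a b assume "a \<in> adjoin S x" "b \<in> adjoin S x"
  then obtain p q where pq: "p \<in> polys_over S" "q \<in> polys_over S" "a = poly p x" "b = poly q x"
    by (auto simp: adjoin_def)
  have "a - b = poly (p - q) x" "a * b = poly (p * q) x"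
    using pq by auto
  then show "a - b \<in> adjoin S x" "a * b \<in> adjoin S x"
    unfolding adjoin_def using pq polys_over_diff polys_over_mult by blast+
qed

lemma adjoin_base: "s \<in> S \<Longrightarrow> s \<in> adjoin S x"
  unfolding adjoin_def
  by (rule image_eqI[of _ _ "monom s 0"]) (auto simp: poly_monom intro: polys_over_monom)

lemma adjoin_gen: "x \<in> adjoin S x"
  unfolding adjoin_def
  by (rule image_eqI[of _ _ "monom 1 1"]) (auto simp: poly_monom intro: polys_over_monom one_in)

text \<open>Hilbert's basis theorem. In a putative non-finitely generated ideal, a sequence of
  representatives \<open>p n\<close> of least degree outside the ideal generated by the earlier ones would have
  a leading coefficient that is a combination of earlier ones, so its leading term cancels.\<close>

theorem noetherian_adjoin:
  assumes noeth: "noetherian_set S"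
  shows "noetherian_set (adjoin S x)"
  unfolding noetherian_set_def
proof (intro allI impI)
  define T where "T = adjoin S x"
  interpret T: subring_set T
    unfolding T_def by (rule subring_adjoin)
  fix Q assume "Q \<subseteq> adjoin S x"
  then have QT: "Q \<subseteq> T" by (simp add: T_def)
  define I where "I = ideal_gen T Q"
  have QI: "Q \<subseteq> I" using T.ideal_gen_base by (auto simp: I_def)
  have IT: "I \<subseteq> T" unfolding I_def by (rule T.ideal_gen_subset[OF QT])
  show "\<exists>Q0\<subseteq>Q. finite Q0 \<and> Q \<subseteq> ideal_gen (adjoin S x) Q0"
  proof (rule ccontr)
    assume contra: "\<not> ?thesis"
    \<comment> \<open>Each element of a finite \<open>B\<close> involves only finitely many members
      of \<open>Q\<close>, so a finite \<open>B\<close> generating \<open>Q\<close> would yield a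
      finite generating subset of \<open>Q\<close>.\<close>
    have escape: "\<exists>q\<in>I. q \<notin> ideal_gen T B" if B: "finite B" "B \<subseteq> I" for B
    proof (rule ccontr)
      assume "\<not> ?thesis"
      then have 1: "Q \<subseteq> ideal_gen T B" using QI by auto
      obtain Q0 where Q0: "Q0 \<subseteq> Q" "finite Q0" "B \<subseteq> ideal_gen T Q0"
        using finite_subset_ideal_gen[of B T Q] B by (auto simp: I_def)
      have "Q \<subseteq> ideal_gen T Q0" using 1 T.ideal_gen_trans[OF Q0(3)] by auto
      then show False using contra Q0 by (auto simp: T_def)
    qed
    define J where "J = (\<lambda>p (n::nat). ideal_gen T ((\<lambda>k. poly (p k) x) ` {..<n}))"
    \<comment> \<open>Candidates are polynomials, not their values at \<open>x\<close>, because one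
      value can have representatives of different degrees.\<close>
    define C where "C = (\<lambda>p n. {r \<in> polys_over S. poly r x \<in> I \<and> poly r x \<notin> J p n})"
    have "\<exists>p. \<forall>n. p n \<in> C p n \<and> (\<forall>r \<in> C p n. degree (p n) \<le> degree r)"
    proof (rule dependent_wellorder_choice)
      fix r :: "'r poly" and f g :: "nat \<Rightarrow> 'r poly" and n :: nat
      assume "\<And>y. y < n \<Longrightarrow> f y = g y"
      then have "J f n = J g n" by (simp add: J_def)
      then show "(r \<in> C f n \<and> (\<forall>r'\<in>C f n. degree r \<le> degree r')) =
        (r \<in> C g n \<and> (\<forall>r'\<in>C g n. degree r \<le> degree r'))"
        by (simp add: C_def)
    next
      fix n :: nat and p :: "nat \<Rightarrow> 'r poly"
      assume IH: "\<And>y. y < n \<Longrightarrow> p y \<in> C p y \<and> (\<forall>r\<in>C p y. degree (p y) \<le> degree r)"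
      have "\<exists>q\<in>I. q \<notin> J p n"
        unfolding J_def by (rule escape) (use IH in \<open>auto simp: C_def\<close>)
      then obtain q where q: "q \<in> I" "q \<notin> J p n" by blast
      then obtain r where "r \<in> polys_over S" "q = poly r x"
        using IT by (auto simp: T_def adjoin_def)
      with q have "r \<in> C p n" by (simp add: C_def)
      then show "\<exists>r. r \<in> C p n \<and> (\<forall>r'\<in>C p n. degree r \<le> degree r')"
        using ex_has_least_nat[of "\<lambda>r. r \<in> C p n" r degree] by blast
    qed
    then obtain p where p_all: "\<forall>n. p n \<in> C p n \<and> (\<forall>r \<in> C p n. degree (p n) \<le> degree r)" ..
    then have p: "p n \<in> C p n" for n by simp
    have p_min: "degree (p n) \<le> degree r" if "r \<in> C p n" for n r
      using p_all that by simp
    define a where "a = (\<lambda>n. lead_coeff (p n))"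
    have pS: "p n \<in> polys_over S" for n using p[of n] by (simp add: C_def)
    then have aS: "range a \<subseteq> S" by (auto simp: a_def polys_over_def)
    obtain Q0 where Q0: "Q0 \<subseteq> range a" "finite Q0" "range a \<subseteq> ideal_gen S Q0"
      using noeth[unfolded noetherian_set_def, rule_format, OF aS] by blast
    obtain D where D: "finite D" "Q0 = a ` D"
      using finite_subset_image[OF Q0(2,1)] by blast
    obtain N where N: "D \<subseteq> {..<N}"
      using finite_nat_iff_bounded[of D] D(1) by blast
    have aN: "a N \<in> ideal_gen S (a ` {..<N})"
      using Q0(3) ideal_gen_mono[of Q0 "a ` {..<N}" S] N D by blast
    define d where "d = degree (p N)"
    \<comment> \<open>The ideals \<open>J p k\<close> grow with \<open>k\<close>, so
      \<open>p N\<close> was already a candidate at stage \<open>k\<close> and the minimal choice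
      there has no larger degree.\<close>
    have deg_le: "degree (p k) \<le> d" if "k < N" for k
    proof -
      have "J p k \<subseteq> J p N" unfolding J_def by (rule ideal_gen_mono) (use that in auto)
      then have "p N \<in> C p k" using p[of N] by (auto simp: C_def)
      then show ?thesis unfolding d_def by (rule p_min)
    qed
    \<comment> \<open>Shifting each \<open>p k\<close> up to degree \<open>d\<close> turns a
      combination of leading coefficients into a polynomial with that combination as its coefficient
      at \<open>d\<close>.\<close>
    have "\<exists>r \<in> polys_over S. poly r x \<in> J p N \<and> degree r \<le> d \<and> coeff r d = b"
      if "b \<in> ideal_gen S (a ` {..<N})" for b
      using that
    proof induction
      case zero
      show ?case
        by (rule bexI[of _ 0]) (auto simp: J_def polys_over_def intro: zero_in ideal_gen.zero)
    next
      case (step s g h)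
      then obtain r where r: "r \<in> polys_over S" "poly r x \<in> J p N" "degree r \<le> d" "coeff r d = h"
        by blast
      obtain k where k: "k < N" "g = a k" using step(2) by auto
      define m where "m = monom s (d - degree (p k)) * p k"
      have "poly m x \<in> J p N"
      proof -
        have "poly (monom s (d - degree (p k))) x \<in> T"
          using step(1) polys_over_monom by (auto simp: T_def adjoin_def)
        then show ?thesis
          unfolding m_def J_def poly_mult using k(1)
          by (intro T.ideal_gen_mult T.ideal_gen_base) auto
      qed
      moreover have "m \<in> polys_over S"
        unfolding m_def using step(1) by (intro polys_over_mult polys_over_monom pS)
      moreover have "degree m \<le> d"
        unfolding m_def using deg_le[OF k(1)] degree_monom_le[of s "d - degree (p k)"]
        by (intro order.trans[OF degree_mult_le]) linarith
      moreover have "coeff m d = s * g"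
        unfolding m_def using deg_le[OF k(1)] by (simp add: coeff_monom_mult k(2) a_def)
      ultimately show ?case
        using r by (intro bexI[of _ "m + r"])
          (auto simp: J_def intro: polys_over_add ideal_gen_add degree_add_le)
    qed
    from this[OF aN] obtain r where r: "r \<in> polys_over S" "poly r x \<in> J p N" "degree r \<le> d"
      "coeff r d = a N"
      by blast
    have "J p N \<subseteq> I"
    proof -
      have "(\<lambda>k. poly (p k) x) ` {..<N} \<subseteq> I" using p by (auto simp: C_def)
      then show ?thesis unfolding J_def I_def by (rule T.ideal_gen_trans)
    qed
    \<comment> \<open>Subtracting \<open>r\<close> keeps the class modulo \<open>J p N\<close>, so
      the difference is still a candidate at stage \<open>N\<close>, contradicting minimality once
      its degree drops.\<close>
    moreover have "poly (p N - r) x \<notin> J p N"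
    proof
      assume "poly (p N - r) x \<in> J p N"
      then have "poly (p N - r) x + poly r x \<in> J p N"
        using r(2) unfolding J_def by (rule ideal_gen_add)
      then show False using p[of N] by (simp add: C_def)
    qed
    moreover have "poly (p N - r) x \<in> I"
      using T.ideal_gen_diff[of "poly (p N) x" Q "poly r x"] p[of N] r(2) \<open>J p N \<subseteq> I\<close>
      by (auto simp: C_def I_def)
    ultimately have inC: "p N - r \<in> C p N"
      using pS r(1) by (simp add: C_def polys_over_diff)
    have "degree (p N - r) \<le> d" "coeff (p N - r) d = 0"
      using r by (auto simp: d_def a_def intro: degree_diff_le)
    \<comment> \<open>When \<open>d = 0\<close>, the zero polynomial has coefficient zero at
      \<open>d\<close> although its degree is not below \<open>d\<close>.\<close>
    moreover have "p N - r \<noteq> 0"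
      using \<open>poly (p N - r) x \<notin> J p N\<close> by (auto simp: J_def ideal_gen.zero)
    ultimately have "degree (p N - r) < d"
      by (metis leading_coeff_0_iff order_le_less)
    then show False using p_min[OF inC] by (simp add: d_def)
  qed
qed

end

section \<open>Polynomial functions on finite-dimensional space are noetherian\<close>

lemma subring_poly_fun: "subring_set (poly_fun m)"
proof
  show "1 \<in> poly_fun m" using pf_const[of 1 m] by (simp add: one_fun_def)
next
  fix a b :: "'a list \<Rightarrow> 'a" assume ab: "a \<in> poly_fun m" "b \<in> poly_fun m"
  show "a * b \<in> poly_fun m" using pf_mult[OF ab] by (simp add: times_fun_def)
  show "a - b \<in> poly_fun m"
    using pf_add[OF ab(1) pf_mult[OF pf_const[of "-1"] ab(2)]] by (simp add: fun_diff_def)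
qed

text \<open>The function type does not depend on \<open>m\<close>, so \<open>poly_fun m\<close> is
  literally a subring of \<open>poly_fun (Suc m)\<close> and the basis theorem can be
  iterated.\<close>

lemma poly_fun_Suc: "poly_fun (Suc m) = adjoin (poly_fun m) (\<lambda>x. x ! m)"
proof
  interpret m: subring_set "poly_fun m :: ('a list \<Rightarrow> 'a) set" by (rule subring_poly_fun)
  interpret adj: subring_set "adjoin (poly_fun m) (\<lambda>x. x ! m) :: ('a list \<Rightarrow> 'a) set"
    by (rule m.subring_adjoin)
  show "(poly_fun (Suc m) :: ('a list \<Rightarrow> 'a) set) \<subseteq> adjoin (poly_fun m) (\<lambda>x. x ! m)"
  proof
    fix p :: "'a list \<Rightarrow> 'a" assume "p \<in> poly_fun (Suc m)"
    then show "p \<in> adjoin (poly_fun m) (\<lambda>x. x ! m)"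
    proof induction
      case (pf_const c)
      then show ?case by (intro m.adjoin_base poly_fun.pf_const)
    next
      case (pf_var i)
      then show ?case
        using m.adjoin_base[OF poly_fun.pf_var[of i m]] m.adjoin_gen by (cases "i = m") auto
    next
      case (pf_add p q)
      then show ?case using adj.add_in by (fastforce simp: plus_fun_def)
    next
      case (pf_mult p q)
      then show ?case using adj.mult_in by (fastforce simp: times_fun_def)
    qed
  qed
next
  interpret Sm: subring_set "poly_fun (Suc m) :: ('a list \<Rightarrow> 'a) set" by (rule subring_poly_fun)
  have sub: "p \<in> poly_fun (Suc m)" if "p \<in> poly_fun m" for p :: "'a list \<Rightarrow> 'a"
    using that by induction (auto intro: poly_fun.intros)
  show "adjoin (poly_fun m) (\<lambda>x. x ! m) \<subseteq> (poly_fun (Suc m) :: ('a list \<Rightarrow> 'a) set)"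
    unfolding adjoin_def polys_over_def poly_altdef
    by (intro image_subsetI Sm.sum_in Sm.mult_in Sm.power_in pf_var) (auto intro: sub)
qed

lemma noetherian_poly_fun: "noetherian_set (poly_fun m :: ('a::field list \<Rightarrow> 'a) set)"
proof (induction m)
  case 0
  have const: "\<exists>c. p = (\<lambda>x. c)" if "p \<in> poly_fun 0" for p :: "'a list \<Rightarrow> 'a"
    using that by induction auto
  interpret S: subring_set "poly_fun 0 :: ('a list \<Rightarrow> 'a) set" by (rule subring_poly_fun)
  show ?case unfolding noetherian_set_def
  proof (intro allI impI)
    fix Q :: "('a list \<Rightarrow> 'a) set" assume Q: "Q \<subseteq> poly_fun 0"
    show "\<exists>Q0\<subseteq>Q. finite Q0 \<and> Q \<subseteq> ideal_gen (poly_fun 0) Q0"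
    proof (cases "Q \<subseteq> {0}")
      case True
      then show ?thesis by (intro exI[of _ "{}"]) (auto intro: ideal_gen.zero)
    next
      case False
      then obtain q where q: "q \<in> Q" "q \<noteq> 0" by auto
      then obtain c where c: "q = (\<lambda>x. c)" using const Q by blast
      with q have "c \<noteq> 0" by (auto simp: zero_fun_def)
      have "p \<in> ideal_gen (poly_fun 0) {q}" if p: "p \<in> Q" for p
      proof -
        obtain b where b: "p = (\<lambda>x. b)" using const Q p by blast
        have "p = (\<lambda>x. b / c) * q" using \<open>c \<noteq> 0\<close> by (simp add: b c times_fun_def)
        then show ?thesis
          using S.ideal_gen_mult[OF S.ideal_gen_base pf_const] by blast
      qed
      then show ?thesis using q by (intro exI[of _ "{q}"]) auto
    qed
  qed
next
  case (Suc m)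
  then show ?case
    unfolding poly_fun_Suc by (intro subring_set.noetherian_adjoin subring_poly_fun)
qed

section \<open>The Nullstellensatz in countably many variables\<close>

text \<open>Functions of a whole assignment \<open>v\<close> admit any index type while each
  polynomial still involves finitely many variables; evaluation at a point is application.\<close>

inductive_set coord_poly :: "(('i \<Rightarrow> 'a::comm_ring_1) \<Rightarrow> 'a) set" where
  const: "(\<lambda>_. c) \<in> coord_poly"
| var: "(\<lambda>v. v i) \<in> coord_poly"
| add: "p \<in> coord_poly \<Longrightarrow> q \<in> coord_poly \<Longrightarrow> p + q \<in> coord_poly"
| mult: "p \<in> coord_poly \<Longrightarrow> q \<in> coord_poly \<Longrightarrow> p * q \<in> coord_poly"

interpretation coord_poly: subring_set "coord_poly :: (('i \<Rightarrow> 'a::comm_ring_1) \<Rightarrow> 'a) set"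
proof
  show "1 \<in> (coord_poly :: (('i \<Rightarrow> 'a) \<Rightarrow> 'a) set)"
    using coord_poly.const[of 1] by (simp add: one_fun_def)
next
  fix p q :: "('i \<Rightarrow> 'a) \<Rightarrow> 'a"
  assume pq: "p \<in> coord_poly" "q \<in> coord_poly"
  show "p - q \<in> coord_poly"
    using coord_poly.add[OF pq(1) coord_poly.mult[OF coord_poly.const[of "-1"] pq(2)]]
    by (simp add: plus_fun_def times_fun_def fun_diff_def)
  show "p * q \<in> coord_poly"
    using pq by (rule coord_poly.mult)
qed

lemma coord_poly_subst:
  assumes "p \<in> coord_poly" and "\<And>i. \<sigma> i \<in> coord_poly"
  shows "(\<lambda>v. p (\<lambda>i. \<sigma> i v)) \<in> coord_poly"
  using assms(1)
proof induction
  case (add p q)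
  then show ?case using coord_poly.add by (fastforce simp: plus_fun_def)
next
  case (mult p q)
  then show ?case using coord_poly.mult by (fastforce simp: times_fun_def)
qed (auto intro: coord_poly.const assms(2))

text \<open>Transfers polynomials on lists to the infinite variable set, with \<iota> naming the
  variables that hold the list entries.\<close>

lemma poly_fun_coord_poly:
  assumes "p \<in> poly_fun m"
  shows "(\<lambda>v. p (map (\<lambda>j. v (\<iota> j)) [0..<m])) \<in> coord_poly"
  using assms
proof induction
  case (pf_add p q)
  then show ?case using coord_poly.add by (fastforce simp: plus_fun_def)
next
  case (pf_mult p q)
  then show ?case using coord_poly.mult by (fastforce simp: times_fun_def)
qed (auto intro: coord_poly.const coord_poly.var)

lemma sum_fun_apply: "(\<Sum>i\<in>I. f i) v = (\<Sum>i\<in>I. f i v)"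
  by (induction I rule: infinite_finite_induct) auto

lemma power_fun_apply: "(f ^ n) v = f v ^ n"
  by (induction n) auto

lemma coord_poly_poly: "(\<lambda>v. poly h (v i)) \<in> coord_poly"
proof -
  have "(\<lambda>v. poly h (v i)) = (\<Sum>k\<le>degree h. (\<lambda>_. coeff h k) * (\<lambda>v. v i) ^ k)"
    by (simp add: fun_eq_iff poly_altdef sum_fun_apply power_fun_apply)
  then show ?thesis
    by (simp add: coord_poly.sum_in coord_poly.mult_in coord_poly.power_in
        coord_poly.const coord_poly.var)
qed

section \<open>Countable dimension of the polynomial ring\<close>

interpretation fun_space: vector_space "\<lambda>(c::'a::field) (f :: 'b \<Rightarrow> 'a) v. c * f v"
  by unfold_locales (auto simp: algebra_simps fun_eq_iff)

text \<open>Monomials are indexed by lists of variables. For countable \<open>'i\<close> there are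
  only countably many such lists, which bounds the dimension.\<close>

lemma coord_poly_subset_span:
  "(coord_poly :: (('i \<Rightarrow> 'a::field) \<Rightarrow> 'a) set)
    \<subseteq> fun_space.span (range (\<lambda>l v. prod_list (map v l)))"
  (is "_ \<subseteq> fun_space.span ?M")
proof
  have mono: "(\<lambda>v. prod_list (map v l)) \<in> fun_space.span ?M" for l :: "'i list"
    by (rule fun_space.span_base) simp
  have mono_mult: "(\<lambda>v. prod_list (map v l)) * q \<in> fun_space.span ?M"
    if "q \<in> fun_space.span ?M" for l q
    using that
  proof (induction rule: fun_space.span_induct_alt)
    case base
    show ?case by (simp only: mult_zero_right mult_zero_left fun_space.span_zero)
  next
    case (step c x y)
    then obtain k where k: "x = (\<lambda>v. prod_list (map v k))" by auto
    have eq: "(\<lambda>v. prod_list (map v l)) * ((\<lambda>v. c * x v) + y) =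
      (\<lambda>v. c * prod_list (map v (l @ k))) + (\<lambda>v. prod_list (map v l)) * y"
      by (simp add: k fun_eq_iff algebra_simps)
    show ?case
      unfolding eq by (intro fun_space.span_add fun_space.span_scale mono step(2))
  qed
  have span_mult: "p * q \<in> fun_space.span ?M"
    if "p \<in> fun_space.span ?M" "q \<in> fun_space.span ?M" for p q
    using that(1)
  proof (induction rule: fun_space.span_induct_alt)
    case base
    show ?case by (simp only: mult_zero_right mult_zero_left fun_space.span_zero)
  next
    case (step c x y)
    then obtain k where k: "x = (\<lambda>v. prod_list (map v k))" by auto
    have eq: "((\<lambda>v. c * x v) + y) * q = (\<lambda>v. c * ((\<lambda>v. prod_list (map v k)) * q) v) + y * q"
      by (simp add: k fun_eq_iff algebra_simps)
    show ?case
      unfolding eq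
      by (intro fun_space.span_add fun_space.span_scale mono_mult that(2) step(2))
  qed
  fix p :: "('i \<Rightarrow> 'a) \<Rightarrow> 'a"
  assume "p \<in> coord_poly"
  then show "p \<in> fun_space.span ?M"
  proof induction
    case (const c)
    show ?case using fun_space.span_scale[OF mono[of "[]"], of c] by simp
  next
    case (var i)
    show ?case using mono[of "[i]"] by simp
  next
    case (add p q)
    from add.IH show ?case by (rule fun_space.span_add)
  next
    case (mult p q)
    from mult.IH show ?case by (rule span_mult)
  qed
qed

text \<open>Pigeonhole: each \<open>g b\<close> lies in the span of a finite set of monomials, and
  there are only countably many such sets. Hence infinitely many \<open>b\<close> share one set
  \<open>T\<close>, whose span has dimension at most \<open>card T\<close>.\<close>

lemma dependent_family_in_coord_poly:
  fixes g :: "'a::field \<Rightarrow> ('i::countable \<Rightarrow> 'a) \<Rightarrow> 'a"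
  assumes "uncountable (UNIV :: 'a set)" and "inj g" and g: "\<And>b. g b \<in> coord_poly"
  obtains B c where "finite B" "\<exists>b\<in>B. c b \<noteq> 0" "\<And>v. (\<Sum>b\<in>B. c b * g b v) = 0"
proof -
  let ?M = "range (\<lambda>(l::'i list) (v :: 'i \<Rightarrow> 'a). prod_list (map v l))"
  have "\<exists>t. finite t \<and> t \<subseteq> ?M \<and> g b \<in> fun_space.span t" for b
  proof -
    have "g b \<in> fun_space.span ?M" using g coord_poly_subset_span by blast
    then obtain t r where t: "finite t" "t \<subseteq> ?M" "g b = (\<Sum>a\<in>t. (\<lambda>v. r a * a v))"
      by (auto simp: fun_space.span_explicit)
    then have "g b \<in> fun_space.span t"
      by (auto intro!: fun_space.span_sum fun_space.span_scale intro: fun_space.span_base)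
    with t show ?thesis by blast
  qed
  then obtain t where t: "\<And>b. finite (t b)" "\<And>b. t b \<subseteq> ?M" "\<And>b. g b \<in> fun_space.span (t b)"
    by metis
  have "countable (range t)"
    by (rule countable_subset[OF _ countable_Collect_finite_subset[of ?M]]) (use t in auto)
  moreover have "\<exists>T\<in>range t. infinite (t -` {T})"
  proof (rule ccontr)
    assume "\<not> ?thesis"
    then have "countable (\<Union>T\<in>range t. t -` {T})"
      using \<open>countable (range t)\<close> by (intro countable_UN) (auto intro: countable_finite)
    moreover have "(\<Union>T\<in>range t. t -` {T}) = UNIV" by auto
    ultimately show False using assms(1) by simp
  qed
  then obtain T where T: "T \<in> range t" "infinite (t -` {T})" by blast
  have "finite T" using t(1) T(1) by auto
  obtain B where B: "B \<subseteq> t -` {T}" "finite B" "card B = Suc (card T)"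
    using infinite_arbitrarily_large[OF T(2)] by blast
  have inj: "inj_on g B" using assms(2) by (rule inj_on_subset) simp
  have "g ` B \<subseteq> fun_space.span T" using B(1) t(3) by force
  then have "fun_space.dependent (g ` B)"
    using fun_space.independent_span_bound[OF \<open>finite T\<close>, of "g ` B"] B(3) card_image[OF inj]
    by auto
  then obtain u where u: "\<exists>f\<in>g ` B. u f \<noteq> 0" "(\<Sum>f\<in>g ` B. (\<lambda>v. u f * f v)) = 0"
    using fun_space.dependent_finite[of "g ` B"] B(2) by auto
  have "(\<Sum>b\<in>B. u (g b) * g b v) = 0" for v
    using fun_cong[OF u(2), of v] by (simp add: sum.reindex[OF inj] sum_fun_apply)
  then show thesis using that[of B "\<lambda>b. u (g b)"] B(2) u(1) by blast
qed

text \<open>Every linear factor is invertible modulo the ideal, so the roots of \<open>h\<close> can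
  be divided out one by one until a nonzero constant remains.\<close>

lemma one_in_ideal_if_poly_in_ideal:
  fixes h :: "'a::field poly"
  assumes closed: "alg_closed_field TYPE('a)"
    and inv: "\<And>b. \<exists>g\<in>coord_poly. 1 - g * (\<lambda>v. v i - b) \<in> ideal_gen coord_poly G"
    and "h \<noteq> 0" and "(\<lambda>v. poly h (v i)) \<in> ideal_gen coord_poly G"
  shows "1 \<in> ideal_gen coord_poly G"
  using assms(3,4)
proof (induction "degree h" arbitrary: h)
  case 0
  then obtain c where c: "h = [:c:]" "c \<noteq> 0" by (metis degree_eq_zeroE pCons_0_0)
  have "(\<lambda>_. inverse c) * (\<lambda>v. poly h (v i)) \<in> ideal_gen coord_poly G"
    using 0 by (intro coord_poly.ideal_gen_mult coord_poly.const)
  moreover have "(\<lambda>_. inverse c) * (\<lambda>v. poly h (v i)) = 1"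
    using c by (simp add: fun_eq_iff)
  ultimately show ?case by (simp only:)
next
  case (Suc n)
  then obtain b where "poly h b = 0"
    using closed by (metis alg_closed_field_def zero_less_Suc)
  then obtain k where k: "h = [:- b, 1:] * k" by (auto simp: poly_eq_0_iff_dvd)
  with Suc have "k \<noteq> 0" by auto
  then have deg: "n = degree k" using Suc(2) by (simp add: k degree_mult_eq del: mult_pCons_left)
  obtain g where g: "g \<in> coord_poly" "1 - g * (\<lambda>v. v i - b) \<in> ideal_gen coord_poly G"
    using inv by blast
  let ?k = "\<lambda>v. poly k (v i)"
  have "?k * (1 - g * (\<lambda>v. v i - b)) + g * (\<lambda>v. poly h (v i)) \<in> ideal_gen coord_poly G"
    using g Suc by (intro ideal_gen_add coord_poly.ideal_gen_mult coord_poly_poly)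
  moreover have "?k * (1 - g * (\<lambda>v. v i - b)) + g * (\<lambda>v. poly h (v i)) = ?k"
    by (simp add: fun_eq_iff k algebra_simps)
  ultimately show ?case using Suc(1)[OF deg \<open>k \<noteq> 0\<close>] by simp
qed

text \<open>If no specialisation \<open>x\<^sub>i = b\<close> were consistent, every \<open>x\<^sub>i - b\<close> would have an inverse \<open>g b\<close>
  modulo the ideal. The polynomial ring has countable dimension, so uncountably many \<open>g b\<close> are
  linearly dependent, and clearing denominators puts a nonzero polynomial in \<open>x\<^sub>i\<close> into the ideal.\<close>

lemma consistent_specialisation:
  fixes G :: "(('i::countable \<Rightarrow> 'a::field) \<Rightarrow> 'a) set"
  assumes closed: "alg_closed_field TYPE('a)"
    and uncountable: "uncountable (UNIV :: 'a set)"
    and proper: "1 \<notin> ideal_gen coord_poly G"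
  shows "\<exists>b. 1 \<notin> ideal_gen coord_poly (insert (\<lambda>v. v i - b) G)"
proof (rule ccontr)
  assume "\<not> ?thesis"
  then have inv: "\<exists>g\<in>coord_poly. 1 - g * (\<lambda>v. v i - b) \<in> ideal_gen coord_poly G" for b
    using coord_poly.ideal_gen_insertD by blast
  then obtain g where g: "\<And>b. g b \<in> coord_poly"
    and g_inv: "\<And>b. 1 - g b * (\<lambda>v. v i - b) \<in> ideal_gen coord_poly G"
    by metis
  \<comment> \<open>A common inverse of \<open>v i - a\<close> and \<open>v i - b\<close> would put
    \<open>(a - b) * g a\<close> into the ideal. For distinct \<open>a\<close> and \<open>b\<close>
    this makes \<open>g a\<close> vanish modulo the ideal, although it is invertible there.\<close>
  have "inj g"
  proof
    fix a b assume eq: "g a = g b"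
    have "(1 - g a * (\<lambda>v. v i - a)) - (1 - g b * (\<lambda>v. v i - b)) \<in> ideal_gen coord_poly G"
      by (intro coord_poly.ideal_gen_diff g_inv)
    moreover have "(1 - g a * (\<lambda>v. v i - a)) - (1 - g b * (\<lambda>v. v i - b)) = (\<lambda>_. a - b) * g a"
      by (simp add: eq fun_eq_iff algebra_simps)
    ultimately have ab: "(\<lambda>_. a - b) * g a \<in> ideal_gen coord_poly G" by simp
    show "a = b"
    proof (rule ccontr)
      assume "a \<noteq> b"
      have "(\<lambda>v. (v i - a) / (a - b)) = (\<lambda>v. poly [:- a / (a - b), 1 / (a - b):] (v i))"
        by (simp add: fun_eq_iff diff_divide_distrib)
      then have "(\<lambda>v. (v i - a) / (a - b)) \<in> (coord_poly :: (('i \<Rightarrow> 'a) \<Rightarrow> 'a) set)"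
        using coord_poly_poly by metis
      then have "(\<lambda>v. (v i - a) / (a - b)) * ((\<lambda>_. a - b) * g a) + (1 - g a * (\<lambda>v. v i - a))
        \<in> ideal_gen coord_poly G"
        by (intro ideal_gen_add coord_poly.ideal_gen_mult ab g_inv)
      moreover have "(\<lambda>v. (v i - a) / (a - b)) * ((\<lambda>_. a - b) * g a) + (1 - g a * (\<lambda>v. v i - a)) = 1"
        using \<open>a \<noteq> b\<close> by (simp add: fun_eq_iff)
      ultimately show False using proper by simp
    qed
  qed
  then obtain B c where B: "finite B" "\<exists>b\<in>B. c b \<noteq> 0" "\<And>v. (\<Sum>b\<in>B. c b * g b v) = 0"
    using dependent_family_in_coord_poly[OF uncountable] g by metis
  \<comment> \<open>The numerators obtained from the partial fractions \<open>c b / (X - b)\<close>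
    over the common denominator. At a point of \<open>B\<close> only its own numerator can be
    nonzero.\<close>
  define k where "k = (\<lambda>b. smult (c b) (\<Prod>a\<in>B - {b}. [:- a, 1:]))"
  define h where "h = (\<Sum>b\<in>B. k b)"
  have "h \<noteq> 0"
  proof -
    obtain b where b: "b \<in> B" "c b \<noteq> 0" using B(2) by blast
    have "poly h b = (\<Sum>b'\<in>B. if b' = b then poly (k b) b else 0)"
      unfolding h_def poly_sum
    proof (rule sum.cong)
      fix b' assume "b' \<in> B"
      show "poly (k b') b = (if b' = b then poly (k b) b else 0)"
        using b(1) B(1) by (auto simp: k_def poly_prod)
    qed simp
    also have "\<dots> = poly (k b) b" using b(1) B(1) by simp
    also have "\<dots> \<noteq> 0" using b(2) B(1) by (auto simp: k_def poly_prod)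
    finally show ?thesis by auto
  qed
  moreover have "(\<lambda>v. poly h (v i)) \<in> ideal_gen coord_poly G"
  proof -
    \<comment> \<open>Since \<open>k b\<close> times \<open>X - b\<close> is \<open>c b\<close>
      times the common denominator, the parts containing \<open>g b\<close> cancel by linear
      dependence and only \<open>h\<close> survives.\<close>
    have "(\<Sum>b\<in>B. (\<lambda>v. poly (k b) (v i)) * (1 - g b * (\<lambda>v. v i - b))) \<in> ideal_gen coord_poly G"
      by (intro coord_poly.ideal_gen_sum coord_poly.ideal_gen_mult coord_poly_poly g_inv)
    moreover have "(\<Sum>b\<in>B. (\<lambda>v. poly (k b) (v i)) * (1 - g b * (\<lambda>v. v i - b))) =
      (\<lambda>v. poly h (v i))"
    proof
      fix v :: "'i \<Rightarrow> 'a"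
      define P where "P = (\<Prod>a\<in>B. v i - a)"
      have k: "poly (k b) (v i) * (v i - b) = c b * P" if "b \<in> B" for b
        using B(1) that by (simp add: k_def P_def poly_prod prod.remove[of B b])
      have "(\<Sum>b\<in>B. (\<lambda>v. poly (k b) (v i)) * (1 - g b * (\<lambda>v. v i - b))) v =
        (\<Sum>b\<in>B. poly (k b) (v i) - P * (c b * g b v))"
        unfolding sum_fun_apply by (intro sum.cong refl) (use k in \<open>simp add: algebra_simps\<close>)
      also have "\<dots> = poly h (v i)"
        by (simp add: sum_subtractf h_def poly_sum B(3) flip: sum_distrib_left)
      finally show "(\<Sum>b\<in>B. (\<lambda>v. poly (k b) (v i)) * (1 - g b * (\<lambda>v. v i - b))) v =
        poly h (v i)" .
    qed
    ultimately show ?thesis by simp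
  qed
  ultimately show False
    using one_in_ideal_if_poly_in_ideal[OF closed inv] proper by blast
qed

text \<open>A maximal consistent system \<open>M\<close> fixes the value of every variable by
  \<open>consistent_specialisation\<close>. The resulting point \<open>w\<close> solves it: modulo
  \<open>M\<close> a polynomial equals its value at \<open>w\<close>, and a nonzero value would be a
  unit.\<close>

theorem nullstellensatz_countable:
  fixes G :: "(('i::countable \<Rightarrow> 'a::field) \<Rightarrow> 'a) set"
  assumes closed: "alg_closed_field TYPE('a)"
    and uncountable: "uncountable (UNIV :: 'a set)"
    and G: "G \<subseteq> coord_poly"
    and proper: "1 \<notin> ideal_gen coord_poly G"
  shows "\<exists>v. \<forall>g\<in>G. g v = 0"
proof -
  define \<A> where "\<A> = {H. G \<subseteq> H \<and> 1 \<notin> ideal_gen coord_poly H}"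
  have "\<exists>M\<in>\<A>. \<forall>H\<in>\<A>. M \<subseteq> H \<longrightarrow> H = M"
  proof (rule subset_Zorn_nonempty)
    show "\<A> \<noteq> {}" using proper by (auto simp: \<A>_def)
  next
    fix \<C> assume \<C>: "\<C> \<noteq> {}" "subset.chain \<A> \<C>"
    have "1 \<notin> ideal_gen coord_poly (\<Union>\<C>)"
    proof
      assume "1 \<in> ideal_gen coord_poly (\<Union>\<C>)"
      then obtain G0 where G0: "G0 \<subseteq> \<Union>\<C>" "finite G0" "1 \<in> ideal_gen coord_poly G0"
        using ideal_gen_finite_support[of 1 coord_poly "\<Union>\<C>"] by blast
      then obtain H where "H \<in> \<C>" "G0 \<subseteq> H"
        using finite_subset_Union_chain[of G0 \<C> \<A>] \<C> by blast
      then show False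
        using G0(3) ideal_gen_mono[of G0 H] \<C>(2) by (auto simp: \<A>_def subset.chain_def)
    qed
    moreover have "G \<subseteq> \<Union>\<C>" using \<C> unfolding \<A>_def subset.chain_def by blast
    ultimately show "\<Union>\<C> \<in> \<A>" by (simp add: \<A>_def)
  qed
  then obtain M where M: "G \<subseteq> M" "1 \<notin> ideal_gen coord_poly M"
    and max: "\<And>H. G \<subseteq> H \<Longrightarrow> 1 \<notin> ideal_gen coord_poly H \<Longrightarrow> M \<subseteq> H \<Longrightarrow> H = M"
    by (auto simp: \<A>_def)
  have "\<exists>b. (\<lambda>v. v i - b) \<in> M" for i
  proof -
    obtain b where "1 \<notin> ideal_gen coord_poly (insert (\<lambda>v. v i - b) M)"
      using consistent_specialisation[OF closed uncountable M(2)] by blast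
    then have "insert (\<lambda>v. v i - b) M = M" using M(1) by (intro max) auto
    then show ?thesis by blast
  qed
  then obtain w where w: "\<And>i. (\<lambda>v. v i - w i) \<in> M" by metis
  have eval: "p - (\<lambda>_. p w) \<in> ideal_gen coord_poly M" if "p \<in> coord_poly" for p
    using that
  proof induction
    case (const c)
    have "(\<lambda>_. c) - (\<lambda>_. c) = (0 :: ('i \<Rightarrow> 'a) \<Rightarrow> 'a)" by simp
    then show ?case by (simp only: ideal_gen.zero)
  next
    case (var i)
    show ?case using coord_poly.ideal_gen_base[OF w] by (simp add: fun_diff_def)
  next
    case (add p q)
    have "(p + q) - (\<lambda>_. (p + q) w) = (p - (\<lambda>_. p w)) + (q - (\<lambda>_. q w))"
      by (simp add: fun_eq_iff)
    then show ?case using add by (simp only: ideal_gen_add)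
  next
    case (mult p q)
    have "(p * q) - (\<lambda>_. (p * q) w) = q * (p - (\<lambda>_. p w)) + (\<lambda>_. p w) * (q - (\<lambda>_. q w))"
      by (simp add: fun_eq_iff algebra_simps)
    then show ?case
      using mult by (simp only: ideal_gen_add coord_poly.ideal_gen_mult coord_poly.const)
  qed
  show ?thesis
  proof (intro exI ballI, rule ccontr)
    fix g assume g: "g \<in> G" "g w \<noteq> 0"
    have "(\<lambda>_. inverse (g w)) * (g - (g - (\<lambda>_. g w))) \<in> ideal_gen coord_poly M"
      using g G M(1)
      by (intro coord_poly.ideal_gen_mult coord_poly.ideal_gen_diff coord_poly.ideal_gen_base
          eval coord_poly.const) auto
    moreover have "(\<lambda>_. inverse (g w)) * (g - (g - (\<lambda>_. g w))) = 1"
      using g by (simp add: fun_eq_iff)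
    ultimately show False using M(2) by (simp only:)
  qed
qed

section \<open>Constructible sets as projections of closed sets\<close>

text \<open>The left summand of the index type holds the coordinates of the point, the right one an
  unlimited supply of auxiliary variables.\<close>

definition first_coords :: "nat \<Rightarrow> (nat + nat \<Rightarrow> 'a) \<Rightarrow> 'a list" where
  "first_coords m v = map (\<lambda>j. v (Inl j)) [0..<m]"

definition closed_projection :: "nat \<Rightarrow> 'a::comm_ring_1 list set \<Rightarrow> bool" where
  "closed_projection m X \<longleftrightarrow>
     (\<exists>P\<subseteq>coord_poly. X = first_coords m ` {v. \<forall>p\<in>P. p v = 0})"

text \<open>In a field all products \<open>p * q\<close> vanish exactly when all of \<open>P\<close>
  or all of \<open>Q\<close> vanishes, and images commute with unions.\<close>

lemma closed_projection_Un:
  fixes X Y :: "'a::field list set"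
  assumes "closed_projection m X" and "closed_projection m Y"
  shows "closed_projection m (X \<union> Y)"
proof -
  obtain P where P: "P \<subseteq> coord_poly" "X = first_coords m ` {v. \<forall>p\<in>P. p v = 0}"
    using assms(1) unfolding closed_projection_def by blast
  obtain Q where Q: "Q \<subseteq> coord_poly" "Y = first_coords m ` {v. \<forall>p\<in>Q. p v = 0}"
    using assms(2) unfolding closed_projection_def by blast
  define R where "R = (\<lambda>(p, q). p * q) ` (P \<times> Q)"
  have "{v. \<forall>r\<in>R. r v = 0} = {v. \<forall>p\<in>P. p v = 0} \<union> {v. \<forall>p\<in>Q. p v = 0}"
    by (auto simp: R_def)
  moreover have "R \<subseteq> coord_poly"
    unfolding R_def
    using P(1) Q(1) by (auto intro: coord_poly.mult)
  ultimately show ?thesis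
    unfolding closed_projection_def P(2) Q(2)
    by (intro exI[of _ R]) (simp add: image_Un)
qed

lemma closed_projection_empty: "closed_projection m {}"
  unfolding closed_projection_def
  by (rule exI[of _ "{1}"]) (auto intro: coord_poly.one_in)

text \<open>A union of basic open sets \<open>q\<^sub>k \<noteq> 0\<close>, finite by noetherianity, is expressed by
  \<open>\<Sum>\<^sub>k t\<^sub>k q\<^sub>k = 1\<close> in the auxiliary coordinates \<open>t\<^sub>k = v (Inr k)\<close>.\<close>

lemma locally_closed_imp_closed_projection:
  fixes A :: "'a::field list set"
  assumes "affine_alg_set m A" and "locally_closed_in m A S"
  shows "closed_projection m S"
proof -
  obtain R where R: "R \<subseteq> poly_fun m" "A = zero_set m R"
    using assms(1) by (auto simp: affine_alg_set_def)
  obtain U C where UC: "zopen_in m A U" "zclosed_in m A C" "S = U \<inter> C"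
    using assms(2) by (auto simp: locally_closed_in_def)
  obtain P where P: "P \<subseteq> poly_fun m" "C = A \<inter> zero_set m P"
    using UC(2) by (auto simp: zclosed_in_def)
  obtain Q where Q: "Q \<subseteq> poly_fun m" "A - U = A \<inter> zero_set m Q" and "U \<subseteq> A"
    using UC(1) by (auto simp: zopen_in_def zclosed_in_def)
  obtain Q0 where Q0: "Q0 \<subseteq> Q" "finite Q0" "Q \<subseteq> ideal_gen (poly_fun m) Q0"
    using noetherian_poly_fun[unfolded noetherian_set_def, rule_format, OF Q(1)] by blast
  obtain qs where qs: "set qs = Q0" using finite_list[OF Q0(2)] by blast
  have "zero_set m Q = zero_set m Q0"
  proof
    show "zero_set m Q \<subseteq> zero_set m Q0" using Q0(1) by (auto simp: zero_set_def)
    have "q x = 0" if "q \<in> Q" "\<forall>p\<in>Q0. p x = 0" for q x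
      using ideal_gen_eval_zero[of q "poly_fun m" Q0 x] that Q0(3) by blast
    then show "zero_set m Q0 \<subseteq> zero_set m Q" by (auto simp: zero_set_def)
  qed
  moreover have "U = A - (A - U)" using \<open>U \<subseteq> A\<close> by blast
  ultimately have S: "S = {x. length x = m \<and> (\<forall>p\<in>R \<union> P. p x = 0) \<and> (\<exists>q\<in>set qs. q x \<noteq> 0)}"
    using Q(2) P(2) R(2) UC(3) qs by (auto simp: zero_set_def)
  define E where "E = (\<Sum>k<length qs. (\<lambda>v. v (Inr k)) * (\<lambda>v. (qs ! k) (first_coords m v))) - 1"
  define T where "T = insert E ((\<lambda>p v. p (first_coords m v)) ` (R \<union> P))"
  have sub: "(\<lambda>v. p (first_coords m v)) \<in> coord_poly" if "p \<in> poly_fun m" for p :: "'a list \<Rightarrow> 'a"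
    unfolding first_coords_def using that by (rule poly_fun_coord_poly)
  have "qs ! k \<in> poly_fun m" if "k < length qs" for k
    using that qs Q0(1) Q(1) nth_mem by blast
  then have "E \<in> coord_poly"
    unfolding E_def
    by (intro coord_poly.diff_in coord_poly.sum_in coord_poly.mult_in coord_poly.one_in
        coord_poly.var sub) auto
  then have "T \<subseteq> coord_poly" using R(1) P(1) sub by (auto simp: T_def)
  moreover have "S = first_coords m ` {v. \<forall>p\<in>T. p v = 0}"
  proof (intro equalityI subsetI)
    fix x assume x: "x \<in> S"
    then obtain k where k: "k < length qs" "(qs ! k) x \<noteq> 0"
      unfolding S by (auto simp: in_set_conv_nth)
    \<comment> \<open>One nonvanishing \<open>q\<close> suffices: its auxiliary variable is the
      inverse of its value, and all others are zero.\<close>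
    define v where "v = case_sum (\<lambda>j. x ! j) (\<lambda>i. if i = k then inverse ((qs ! k) x) else 0)"
    have v: "first_coords m v = x"
      using x by (auto simp: S first_coords_def v_def map_nth)
    have "(\<Sum>i<length qs. v (Inr i) * (qs ! i) x) = (\<Sum>i<length qs. if i = k then 1 else 0)"
      using k by (intro sum.cong) (auto simp: v_def)
    then have "E v = 0" using k by (simp add: E_def sum_fun_apply v)
    then have "\<forall>p\<in>T. p v = 0" using x by (auto simp: T_def v S)
    then show "x \<in> first_coords m ` {v. \<forall>p\<in>T. p v = 0}" using v by blast
  next
    fix x assume "x \<in> first_coords m ` {v. \<forall>p\<in>T. p v = 0}"
    then obtain v where v: "\<And>p. p \<in> T \<Longrightarrow> p v = 0" "x = first_coords m v" by blast
    have "E v = 0" using v(1) by (simp add: T_def)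
    then have "(\<Sum>i<length qs. v (Inr i) * (qs ! i) x) = 1"
      by (simp add: E_def sum_fun_apply v(2))
    then have "\<exists>i<length qs. (qs ! i) x \<noteq> 0"
      by (metis (mono_tags, lifting) lessThan_iff mult_zero_right sum.neutral zero_neq_one)
    then have "\<exists>q\<in>set qs. q x \<noteq> 0" by auto
    moreover have "p x = 0" if "p \<in> R \<union> P" for p
      using v(1)[of "\<lambda>v. p (first_coords m v)"] that v(2) by (auto simp: T_def)
    moreover have "length x = m" by (simp add: v(2) first_coords_def)
    ultimately show "x \<in> S" by (simp add: S)
  qed
  ultimately show ?thesis unfolding closed_projection_def by blast
qed

lemma constructible_imp_closed_projection:
  fixes A :: "'a::field list set"
  assumes "affine_alg_set m A" and "constructible_in m A X"
  shows "closed_projection m X"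
proof -
  obtain \<S> where \<S>: "finite \<S>" "\<And>S. S \<in> \<S> \<Longrightarrow> locally_closed_in m A S" "X = \<Union>\<S>"
    using assms(2) unfolding constructible_in_def by blast
  have "closed_projection m (\<Union>\<S>)"
    using \<S>(1,2)
    by induction
      (auto intro: closed_projection_empty closed_projection_Un
        locally_closed_imp_closed_projection[OF assms(1)])
  then show ?thesis by (simp add: \<S>(3))
qed

lemma constructible_in_subset:
  assumes "constructible_in m A X"
  shows "X \<subseteq> A"
  using assms unfolding constructible_in_def locally_closed_in_def zopen_in_def by blast

section \<open>Projective sequences\<close>

theorem theorem4p2:
  fixes d :: "nat \<Rightarrow> nat"
    and A :: "nat \<Rightarrow> 'a::field list set"
    and F :: "nat \<Rightarrow> nat \<Rightarrow> 'a list \<Rightarrow> 'a list"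
    and X :: "nat \<Rightarrow> 'a list set"
  assumes "alg_closed_field TYPE('a)"
    and "uncountable (UNIV :: 'a set)"
    and "proj_seq_constructible d A F X"
    and "\<forall>n. X n \<noteq> {}"
  shows "proj_limit X F \<noteq> {}"
proof -
  have "proj_seq_affine d A F"
    and con: "constructible_in (d n) (A n) (X n)"
    and FX: "n \<le> m \<Longrightarrow> x \<in> X m \<Longrightarrow> F n m x \<in> X n" for n m x
    using assms(3) unfolding proj_seq_constructible_def by blast+
  then have aff: "affine_alg_set (d n) (A n)"
    and reg: "n \<le> m \<Longrightarrow> regular_map (d m) (A m) (d n) (A n) (F n m)"
    and comp: "n \<le> m \<Longrightarrow> m \<le> k \<Longrightarrow> x \<in> A k \<Longrightarrow> F n k x = F n m (F m k x)" for n m k x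
    unfolding proj_seq_affine_def by blast+
  have XA: "x \<in> A n" if "x \<in> X n" for x n
    using constructible_in_subset[OF con] that by blast
  have "\<forall>n. \<exists>P. P \<subseteq> coord_poly \<and> X n = first_coords (d n) ` {v. \<forall>p\<in>P. p v = 0}"
    using constructible_imp_closed_projection[OF aff con] by (simp add: closed_projection_def)
  from choice[OF this] obtain P where
    "\<forall>n. P n \<subseteq> coord_poly \<and> X n = first_coords (d n) ` {v. \<forall>p\<in>P n. p v = 0}" ..
  then have P: "P n \<subseteq> coord_poly"
    and X: "X n = first_coords (d n) ` {v. \<forall>p\<in>P n. p v = 0}" for n
    by blast+
  define ps where "ps = (\<lambda>n m. SOME ps. length ps = d n \<and> set ps \<subseteq> poly_fun (d m) \<and>
    (\<forall>x\<in>A m. F n m x = map (\<lambda>p. p x) ps))"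
  have "length (ps n m) = d n \<and> set (ps n m) \<subseteq> poly_fun (d m) \<and>
    (\<forall>x\<in>A m. F n m x = map (\<lambda>p. p x) (ps n m))" if "n \<le> m" for n m
    unfolding ps_def by (rule someI_ex) (use reg[OF that] in \<open>auto simp: regular_map_def\<close>)
  then have ps: "n \<le> m \<Longrightarrow> length (ps n m) = d n"
    "n \<le> m \<Longrightarrow> set (ps n m) \<subseteq> poly_fun (d m)"
    "n \<le> m \<Longrightarrow> x \<in> A m \<Longrightarrow> F n m x = map (\<lambda>p. p x) (ps n m)" for n m x
    by blast+
  \<comment> \<open>Variables come in blocks: block \<open>n\<close> holds the coordinates of the
    sought point of \<open>X n\<close> together with its own auxiliary variables.\<close>
  define pt :: "nat \<Rightarrow> (nat \<times> (nat + nat) \<Rightarrow> 'a) \<Rightarrow> 'a list"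
    where "pt = (\<lambda>n v. first_coords (d n) (\<lambda>i. v (n, i)))"
  define rel where "rel = (\<lambda>n m j v. v (n, Inl j) - (ps n m ! j) (pt m v))"
  \<comment> \<open>All equations mentioning only blocks up to \<open>N\<close>: membership in each
    \<open>X n\<close>, and compatibility coordinate by coordinate.\<close>
  define G where "G = (\<lambda>N. (\<Union>n\<in>{..N}. (\<lambda>p v. p (\<lambda>i. v (n, i))) ` P n) \<union>
    {rel n m j |n m j. n \<le> m \<and> m \<le> N \<and> j < d n})"
  have G_sub: "G N \<subseteq> coord_poly" for N
  proof -
    have "(\<lambda>v. p (\<lambda>i. v (n, i))) \<in> coord_poly" if "p \<in> P n" for n p
    proof -
      have "p \<in> coord_poly" using P[of n] that by (rule subsetD)
      then show ?thesis
        by (rule coord_poly_subst[where \<sigma> = "\<lambda>i v. v (n, i)"]) (rule coord_poly.var)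
    qed
    moreover have "rel n m j \<in> coord_poly" if "n \<le> m" "j < d n" for n m j
    proof -
      have "ps n m ! j \<in> poly_fun (d m)"
        using ps(1,2)[OF that(1)] that(2) nth_mem[of j "ps n m"] by (simp add: subset_iff)
      then have "(\<lambda>v. (ps n m ! j) (pt m v)) \<in> coord_poly"
        unfolding pt_def first_coords_def by (rule poly_fun_coord_poly)
      then have "(\<lambda>v. v (n, Inl j)) - (\<lambda>v. (ps n m ! j) (pt m v)) \<in> coord_poly"
        by (intro coord_poly.diff_in coord_poly.var)
      then show ?thesis by (simp add: rel_def fun_diff_def)
    qed
    ultimately show ?thesis by (auto simp: G_def)
  qed
  have G_mono: "G N \<subseteq> G M" if "N \<le> M" for N M
    using that by (auto simp: G_def intro: order.trans)
  have solvable: "\<exists>v. \<forall>g\<in>G N. g v = 0" for N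
  proof -
    obtain x where x: "x \<in> X N" using assms(4) by blast
    have "\<forall>n\<in>{..N}. \<exists>v. F n N x = first_coords (d n) v \<and> (\<forall>p\<in>P n. p v = 0)"
    proof
      fix n assume "n \<in> {..N}"
      then have "F n N x \<in> X n" using FX x by simp
      then show "\<exists>v. F n N x = first_coords (d n) v \<and> (\<forall>p\<in>P n. p v = 0)"
        unfolding X by blast
    qed
    from bchoice[OF this] obtain u where
      "\<forall>n\<in>{..N}. F n N x = first_coords (d n) (u n) \<and> (\<forall>p\<in>P n. p (u n) = 0)" ..
    then have u: "n \<le> N \<Longrightarrow> F n N x = first_coords (d n) (u n)"
      "n \<le> N \<Longrightarrow> p \<in> P n \<Longrightarrow> p (u n) = 0" for n p
      by simp_all
    \<comment> \<open>Blocks up to \<open>N\<close> come from the images of the single point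
      \<open>x\<close>; later blocks are arbitrary, as \<open>G N\<close> does not mention
      them.\<close>
    define v where "v = (\<lambda>(n, i). u n i)"
    have pt: "pt n v = F n N x" if "n \<le> N" for n
      using u(1)[OF that] by (simp add: pt_def v_def)
    have "rel n m j v = 0" if "n \<le> m" "m \<le> N" "j < d n" for n m j
    proof -
      have "pt m v \<in> A m" using pt[OF that(2)] FX[OF that(2) x] XA by simp
      \<comment> \<open>Functoriality, \<open>F n N x = F n m (F m N x)\<close>, makes the images of
        \<open>x\<close> compatible with each other.\<close>
      then have "pt n v = map (\<lambda>p. p (pt m v)) (ps n m)"
        using pt[of n] pt[of m] that comp[of n m N x] XA[OF x] ps(3)[of n m] by simp
      then have "pt n v ! j = (ps n m ! j) (pt m v)"
        using ps(1)[OF that(1)] that(3) by simp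
      then show ?thesis using that(3) by (simp add: rel_def pt_def first_coords_def)
    qed
    moreover have "p (\<lambda>i. v (n, i)) = 0" if "n \<le> N" "p \<in> P n" for n p
      using u(2)[OF that] by (simp add: v_def)
    ultimately show ?thesis by (intro exI[of _ v]) (auto simp: G_def)
  qed
  have "1 \<notin> ideal_gen coord_poly (\<Union>N. G N)"
  proof
    assume "1 \<in> ideal_gen coord_poly (\<Union>N. G N)"
    then obtain G0 where G0: "G0 \<subseteq> (\<Union>N. G N)" "finite G0" "1 \<in> ideal_gen coord_poly G0"
      using ideal_gen_finite_support[of 1 coord_poly "\<Union>N. G N"] by blast
    have "\<forall>g\<in>G0. \<exists>N. g \<in> G N" using G0(1) by blast
    from bchoice[OF this] obtain N where "\<forall>g\<in>G0. g \<in> G (N g)" ..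
    moreover obtain M where "\<forall>n\<in>N ` G0. n \<le> M"
      using G0(2) finite_nat_set_iff_bounded_le[of "N ` G0"] by auto
    \<comment> \<open>The systems increase with \<open>N\<close>, so finitely many equations already
      lie in one solvable \<open>G M\<close>.\<close>
    ultimately have "G0 \<subseteq> G M" using G_mono by blast
    moreover obtain v where "\<forall>g\<in>G M. g v = 0" using solvable by blast
    ultimately have "(1 :: (nat \<times> (nat + nat) \<Rightarrow> 'a) \<Rightarrow> 'a) v = 0"
      using G0(3) by (intro ideal_gen_eval_zero[of 1 coord_poly G0 v]) auto
    then show False by simp
  qed
  then have "\<exists>w. \<forall>g\<in>\<Union>N. G N. g w = 0"
    by (intro nullstellensatz_countable assms(1,2) UN_least G_sub)
  then obtain w where "\<forall>g\<in>\<Union>N. G N. g w = 0" ..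
  then have w: "g w = 0" if "g \<in> G N" for g N
    using that by blast
  have ptX: "pt n w \<in> X n" for n
  proof -
    have "p (\<lambda>i. w (n, i)) = 0" if "p \<in> P n" for p
    proof -
      have "(\<lambda>v. p (\<lambda>i. v (n, i))) \<in> G n" using that by (auto simp: G_def)
      then show ?thesis by (rule w)
    qed
    then show ?thesis unfolding X pt_def by blast
  qed
  have "pt n w = F n m (pt m w)" if "n \<le> m" for n m
  proof (rule nth_equalityI)
    have eq: "F n m (pt m w) = map (\<lambda>p. p (pt m w)) (ps n m)"
      using ps(3)[OF that XA[OF ptX]] .
    show "length (pt n w) = length (F n m (pt m w))"
      using ps(1)[OF that] unfolding eq by (simp add: pt_def first_coords_def)
    fix j assume "j < length (pt n w)"
    then have j: "j < d n" by (simp add: pt_def first_coords_def)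
    then have "rel n m j \<in> G m" using that unfolding G_def by blast
    then have "rel n m j w = 0" by (rule w)
    then show "pt n w ! j = F n m (pt m w) ! j"
      using j ps(1)[OF that] unfolding eq by (simp add: rel_def pt_def first_coords_def)
  qed
  then have "(\<lambda>n. pt n w) \<in> proj_limit X F"
    using ptX by (simp add: proj_limit_def)
  then show ?thesis by blast
qed

end
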